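(* There exists a function $\varepsilon:\mathbb{N}\to\mathbb{R}$ with $\varepsilon(n)\to 0$ as $n\to\infty$ such that for every integer $n\ge 7$ and every cyclic constant-weight Gray code $G$ for $(1,2,n)$-LRM with weight $w=2$, one has $\mathrm{Eff}(G)\le \frac34+\varepsilon(n)$.
   Context: Write a binary string of length $n$ as $v=v_0v_1\cdots v_{n-1}$ with indices taken modulo $n$. Let $S(n,w)$ be the set of binary strings of length $n$ with exactly $w$ ones (weight $w$). For $0\le j\le n-1$, the string $v'=\tau_j(v)$ is given by $v'_j=0$, $v'_{j+1}=1$ (index mod $n$), and $v'_k=v_k$ for all other $k$. A constant-weight Gray code of weight $w$ and size $N$ for $(1,2,n)$-LRM ("local rank modulation") is a sequence $G=g_0,\dots,g_{N-1}$ of distinct strings in $S(n,w)$ such that for every $0\le i\le N-2$ there is a $j$ with $g_{i+1}=\tau_j(g_i)$. It is cyclic if in addition $g_0=\tau_j(g_{N-1})$ for some $j$. The efficiency of $G$ is $\mathrm{Eff}(G)=N/\binom{n}{w}$. *)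

theory Defs
  imports Complex_Main
begin

text \<open>Binary strings are Boolean lists, with \<^const>\<open>True\<close> for the symbol 1.\<close>

definition strings :: "nat \<Rightarrow> nat \<Rightarrow> bool list set" where
  "strings n w = {v. length v = n \<and> count_list v True = w}"

definition tau :: "nat \<Rightarrow> bool list \<Rightarrow> bool list" where
  "tau j v = v[j := False, Suc j mod length v := True]"

text \<open>
  \<open>tau\<close> is unconditional: nothing is assumed about the old
  entries at positions \<open>j\<close> and \<open>j + 1\<close>. For \<open>n \<ge> 2\<close>, membership of both words in
  \<open>strings n w\<close> forces these entries to be 10 or 01, and in the latter case the word is unchanged.
\<close>

definition gray_code :: "nat \<Rightarrow> nat \<Rightarrow> bool list list \<Rightarrow> bool" where
  "gray_code n w G \<longleftrightarrow>
     G \<noteq> [] \<and> distinct G \<and> set G \<subseteq> strings n w \<and>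
     (\<forall>i. Suc i < length G \<longrightarrow> (\<exists>j<n. G ! Suc i = tau j (G ! i)))"

definition cyclic_gray_code :: "nat \<Rightarrow> nat \<Rightarrow> bool list list \<Rightarrow> bool" where
  "cyclic_gray_code n w G \<longleftrightarrow>
     gray_code n w G \<and> (\<exists>j<n. hd G = tau j (last G))"

definition efficiency :: "nat \<Rightarrow> nat \<Rightarrow> bool list list \<Rightarrow> real" where
  "efficiency n w G = real (length G) / real (n choose w)"

end

theory Submission
  imports Defs "HOL-Real_Asymp.Real_Asymp"
begin

text \<open>
  View a word of weight two as two tokens on a cycle of length \<open>n\<close>; every step of the code moves one
  token forward by one. Lift the positions of the tokens to \<open>x < y < x + n\<close>, and run through the
  cyclic code forever. Each step raises \<open>x + y\<close> by one, so the lifted states at times \<open>t\<close> and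
  \<open>t + 2 * n\<close> agree up to a full turn of both tokens as soon as their gaps \<open>y - x\<close> agree.
  The difference of these two gaps is even and changes by at most two per step, so if it never
  vanishes then it has constant sign, and the bounded gap is strictly monotone along the times
  \<open>0, 2 * n, 4 * n, \<dots>\<close>: a contradiction. Hence a word is repeated after
  \<open>2 * n\<close> steps, the size of the code divides \<open>2 * n\<close>, and the efficiency is
  at most \<open>4 / (n - 1)\<close>, which is much less than \<open>3 / 4\<close> for large \<open>n\<close>.
\<close>

section \<open>Words as sets of positions\<close>

definition ones :: "bool list \<Rightarrow> nat set" where
  "ones v = {i. i < length v \<and> v ! i}"

lemma finite_ones [simp]: "finite (ones v)"
  by (simp add: ones_def)

lemma card_ones: "card (ones v) = count_list v True"
  by (simp add: ones_def count_list_eq_length_filter length_filter_conv_card)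

lemma ones_inject: "length v = length w \<Longrightarrow> ones v = ones w \<Longrightarrow> v = w"
  by (rule nth_equalityI) (auto simp: ones_def set_eq_iff)

lemma length_tau [simp]: "length (tau j v) = length v"
  by (simp add: tau_def)

lemma ones_tau:
  assumes "j < length v" "2 \<le> length v"
  shows "ones (tau j v) = insert (Suc j mod length v) (ones v - {j})"
proof -
  have "Suc j mod length v < length v"
    using assms by (intro mod_less_divisor) linarith
  moreover have "Suc j mod length v \<noteq> j"
    using assms by (auto simp: mod_Suc split: if_splits)
  ultimately show ?thesis
    using assms by (auto simp: ones_def tau_def nth_list_update)
qed

text \<open>Counting ones: overwriting 00 by 01 gains a one and overwriting 11 by 01 loses one,
  while 01 is left fixed. Only 10 remains.\<close>

lemma proper_tau:
  assumes "v \<in> strings n w" "tau j v \<in> strings n w" "tau j v \<noteq> v" "j < n" "2 \<le> n"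
  shows "j \<in> ones v" "Suc j mod n \<notin> ones v"
proof -
  have len: "length v = n" and card: "card (ones v) = w" "card (ones (tau j v)) = w"
    using assms by (auto simp: strings_def card_ones)
  have ones: "ones (tau j v) = insert (Suc j mod n) (ones v - {j})"
    using ones_tau[of j v] assms len by simp
  have neq: "ones (tau j v) \<noteq> ones v"
    using assms(3) ones_inject by force
  show j: "j \<in> ones v"
  proof (rule ccontr)
    assume "j \<notin> ones v"
    then have "ones (tau j v) = insert (Suc j mod n) (ones v)"
      using ones by simp
    then show False
      using neq card by (metis card_insert_disjoint finite_ones insert_absorb n_not_Suc_n)
  qed
  show "Suc j mod n \<notin> ones v"
  proof
    assume "Suc j mod n \<in> ones v"
    moreover have "Suc j mod n \<noteq> j"
      using assms by (auto simp: mod_Suc split: if_splits)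
    ultimately have "ones (tau j v) = ones v - {j}"
      using ones by auto
    then show False
      using j card by (metis card_Diff1_less finite_ones less_irrefl)
  qed
qed

section \<open>Lifting the two tokens from the cycle to the line\<close>

definition lifts :: "nat \<Rightarrow> bool list \<Rightarrow> nat \<times> nat \<Rightarrow> bool" where
  "lifts n v = (\<lambda>(x, y). x < y \<and> y < x + n \<and> ones v = {x mod n, y mod n})"

definition advance :: "nat \<times> nat \<Rightarrow> nat \<times> nat \<Rightarrow> bool" where
  "advance p q \<longleftrightarrow> q = (Suc (fst p), snd p) \<or> q = (fst p, Suc (snd p))"

lemma mod_neq_of_close:
  fixes x y n :: nat
  assumes "x < y" "y < x + n"
  shows "x mod n \<noteq> y mod n"
proof
  assume "x mod n = y mod n"
  then have "n dvd y - x"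
    using assms mod_eq_dvd_iff_nat[of x y n] by simp
  then show False
    using assms by (auto dest: dvd_imp_le)
qed

lemma ex_lift:
  assumes "v \<in> strings n 2"
  shows "\<exists>p. lifts n v p"
proof -
  have "card (ones v) = 2" and len: "length v = n"
    using assms by (auto simp: strings_def card_ones)
  then obtain a b where "ones v = {a, b}" "a \<noteq> b"
    by (auto simp: card_2_iff)
  then obtain a b where ab: "ones v = {a, b}" "a < b"
    by (metis insert_commute linorder_neqE_nat)
  moreover have "a < n" "b < n"
    using ab len by (auto simp: ones_def)
  ultimately have "lifts n v (a, b)"
    by (simp add: lifts_def)
  then show ?thesis ..
qed

text \<open>The target cell is empty, so the moving token can neither run into the other one
  (\<open>Suc x = y\<close>) nor catch it from behind across the seam
  (\<open>Suc y = x + n\<close>). Both strict inequalities of the lift therefore survive.\<close>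

lemma lift_step:
  assumes "lifts n v p" "v \<in> strings n 2" "tau j v \<in> strings n 2" "tau j v \<noteq> v" "j < n" "2 \<le> n"
  shows "\<exists>q. lifts n (tau j v) q \<and> advance p q"
proof -
  obtain x y where p: "p = (x, y)" by fastforce
  have xy: "x < y" "y < x + n" and ov: "ones v = {x mod n, y mod n}"
    using assms(1) by (auto simp: lifts_def p)
  have len: "length v = n"
    using assms by (simp add: strings_def)
  note j = proper_tau[OF assms(2-6)]
  have ones: "ones (tau j v) = insert (Suc j mod n) (ones v - {j})"
    using ones_tau[of j v] assms len by simp
  have neq: "x mod n \<noteq> y mod n"
    using xy by (rule mod_neq_of_close)
  consider "j = x mod n" | "j = y mod n"
    using j(1) ov by auto
  then show ?thesis
  proof cases
    case 1
    then have S: "Suc j mod n = Suc x mod n"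
      by (simp add: mod_Suc_eq)
    then have "Suc x \<noteq> y"
      using j(2) ov by auto
    moreover have "ones (tau j v) = {Suc x mod n, y mod n}"
      using ones ov S 1 neq by auto
    ultimately have "lifts n (tau j v) (Suc x, y)"
      using xy by (simp add: lifts_def)
    then show ?thesis
      by (auto simp: advance_def p)
  next
    case 2
    then have S: "Suc j mod n = Suc y mod n"
      by (simp add: mod_Suc_eq)
    have "Suc y \<noteq> x + n"
    proof
      assume "Suc y = x + n"
      then have "Suc y mod n = x mod n"
        by simp
      then show False
        using j(2) unfolding ov S by simp
    qed
    moreover have "ones (tau j v) = {x mod n, Suc y mod n}"
      using ones ov S 2 neq by auto
    ultimately have "lifts n (tau j v) (x, Suc y)"
      using xy by (simp add: lifts_def)
    then show ?thesis
      by (auto simp: advance_def p)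
  qed
qed

section \<open>Recurrence of the gap\<close>

lemma bounded_gap_recurs:
  fixes X Y :: "nat \<Rightarrow> nat"
  assumes adv: "\<And>t. advance (X t, Y t) (X (Suc t), Y (Suc t))"
    and gap: "\<And>t. X t < Y t" "\<And>t. Y t < X t + n"
  shows "\<exists>t. X (t + 2 * n) = X t + n \<and> Y (t + 2 * n) = Y t + n"
proof (rule ccontr)
  assume no: "\<not> ?thesis"
  have sum: "X (t + k) + Y (t + k) = X t + Y t + k" for t k
  proof (induction k)
    case (Suc k)
    then show ?case using adv[of "t + k"] by (auto simp: advance_def)
  qed simp
  define D where "D t = int (Y t) - int (X t)" for t
  define E where "E t = D (t + 2 * n) - D t" for t
  have D: "0 < D t" "D t < int n" for t
    using gap[of t] by (auto simp: D_def)
  \<comment> \<open>Over \<open>2 * n\<close> steps the two increments sum to \<open>2 * n\<close>,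
    which eliminates the increment of \<open>X\<close>.\<close>
  have even: "E t = 2 * (int (Y (t + 2 * n)) - int (Y t) - int n)" for t
    using sum[of t "2 * n"] by (simp add: E_def D_def)
  have nz: "E t \<noteq> 0" for t
  proof
    assume "E t = 0"
    then have "int (Y (t + 2 * n)) = int (Y t + n)"
      using even[of t] by simp
    then have "Y (t + 2 * n) = Y t + n"
      by (rule of_nat_eq_iff[THEN iffD1])
    then show False
      using no sum[of t "2 * n"] by auto
  qed
  have Dstep: "\<bar>D (Suc t) - D t\<bar> \<le> 1" for t
    using adv[of t] by (auto simp: advance_def D_def)
  have Estep: "\<bar>E (Suc t) - E t\<bar> \<le> 2" for t
    using Dstep[of t] Dstep[of "t + 2 * n"] unfolding E_def by simp
  have E2: "E t \<ge> 2 \<or> E t \<le> - 2" for t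
    using nz[of t] even[of t] by presburger
  \<comment> \<open>Telescoping along the times \<open>2 * n * k\<close>.\<close>
  have iter: "D (2 * n * k) = D 0 + (\<Sum>i<k. E (2 * n * i))" for k
  proof (induction k)
    case (Suc k)
    have "2 * n * Suc k = 2 * n * k + 2 * n"
      by simp
    then have "D (2 * n * Suc k) = D (2 * n * k) + E (2 * n * k)"
      by (simp only: E_def)
    then show ?case
      using Suc.IH by simp
  qed simp
  show False
  proof (cases "E 0 > 0")
    case True
    \<comment> \<open>A positive even value is at least 2, so one step can bring it down to 0 at
      worst, and 0 is excluded.\<close>
    have "E t \<ge> 1" for t
    proof (induction t)
      case (Suc t)
      then show ?case using E2[of t] E2[of "Suc t"] Estep[of t] nz[of "Suc t"] by linarith
    qed (use True in simp)
    \<comment> \<open>After \<open>n\<close> such increments the gap would exceed its bound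
      \<open>n\<close>.\<close>
    then have "(\<Sum>i<n. E (2 * n * i)) \<ge> int n"
      using sum_mono[of "{..<n}" "\<lambda>_. 1" "\<lambda>i. E (2 * n * i)"] by simp
    then show False
      using iter[of n] D[of 0] D[of "2 * n * n"] by linarith
  next
    case False
    have "E t \<le> -1" for t
    proof (induction t)
      case 0
      then show ?case using False E2[of 0] by linarith
    next
      case (Suc t)
      then show ?case using E2[of t] E2[of "Suc t"] Estep[of t] nz[of "Suc t"] by linarith
    qed
    then have "(\<Sum>i<n. E (2 * n * i)) \<le> - int n"
      using sum_mono[of "{..<n}" "\<lambda>i. E (2 * n * i)" "\<lambda>_. - 1"] by simp
    then show False
      using iter[of n] D[of 0] D[of "2 * n * n"] by linarith
  qed
qed

section \<open>Size and efficiency of cyclic codes\<close>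

lemma cyclic_gray_code_step:
  assumes "cyclic_gray_code n w G"
  shows "\<exists>j<n. G ! (Suc t mod length G) = tau j (G ! (t mod length G))"
proof (cases "Suc (t mod length G) = length G")
  case True
  moreover have "G \<noteq> []"
    using assms by (simp add: cyclic_gray_code_def gray_code_def)
  ultimately show ?thesis
    using assms
    by (metis cyclic_gray_code_def diff_Suc_1 hd_conv_nth last_conv_nth mod_Suc)
next
  case False
  then have "Suc t mod length G = Suc (t mod length G)"
    by (simp add: mod_Suc)
  moreover have "Suc (t mod length G) < length G"
    using False assms by (simp add: cyclic_gray_code_def gray_code_def Suc_lessI)
  ultimately show ?thesis
    using assms by (simp add: cyclic_gray_code_def gray_code_def)
qed

theorem cyclic_gray_code_weight2_length_dvd:
  assumes G: "cyclic_gray_code n 2 G" and n: "2 \<le> n"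
  shows "length G dvd 2 * n"
\<comment> \<open>In a code of size one, \<open>tau\<close> fixes the only word and no token moves,
  so the walk below needs at least two words.\<close>
proof (cases "length G = 1")
  case False
  define N where "N = length G"
  define g where "g t = G ! (t mod N)" for t
  have dist: "distinct G" and sub: "set G \<subseteq> strings n 2" and ne: "G \<noteq> []"
    using G by (auto simp: cyclic_gray_code_def gray_code_def)
  then have N: "2 \<le> N"
    using False unfolding N_def by (cases G; cases "tl G") auto
  have mod_N: "t mod N < length G" for t
    using N unfolding N_def by (intro mod_less_divisor) linarith
  have inS: "g t \<in> strings n 2" for t
    using sub nth_mem[OF mod_N] unfolding g_def by blast
  have g_eq: "g s = g t \<longleftrightarrow> s mod N = t mod N" for s t
    unfolding g_def using nth_eq_iff_index_eq[OF dist mod_N mod_N] .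
  have "\<exists>p. \<forall>t. lifts n (g t) (p t) \<and> advance (p t) (p (Suc t))"
  \<comment> \<open>A word has many lifts, so each one must be chosen to continue its
    predecessor.\<close>
  proof (rule dependent_nat_choice)
    show "\<exists>p. lifts n (g 0) p"
      using inS by (rule ex_lift)
  next
    fix p t
    assume p: "lifts n (g t) p"
    obtain j where j: "j < n" "g (Suc t) = tau j (g t)"
      using cyclic_gray_code_step[OF G, of t] unfolding g_def N_def by auto
    have "g (Suc t) \<noteq> g t"
      using N by (auto simp: g_eq mod_Suc)
    then show "\<exists>q. lifts n (g (Suc t)) q \<and> advance p q"
      using lift_step[OF p inS, of j] j n inS[of "Suc t"] by simp
  qed
  then obtain p where p: "\<And>t. lifts n (g t) (p t)" "\<And>t. advance (p t) (p (Suc t))"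
    by blast
  have lift: "fst (p t) < snd (p t)" "snd (p t) < fst (p t) + n"
      "ones (g t) = {fst (p t) mod n, snd (p t) mod n}" for t
    using p(1)[of t] by (auto simp: lifts_def split: prod.splits)
  obtain t where "fst (p (t + 2 * n)) = fst (p t) + n" "snd (p (t + 2 * n)) = snd (p t) + n"
    using bounded_gap_recurs[of "fst \<circ> p" "snd \<circ> p" n] p(2) lift(1,2) by auto
  then have "ones (g (t + 2 * n)) = ones (g t)"
    by (simp add: lift(3))
  then have "g (t + 2 * n) = g t"
    using inS by (intro ones_inject) (auto simp: strings_def)
  \<comment> \<open>The words of the code are distinct, so a repeated word means a repeated index
    modulo \<open>N\<close>.\<close>
  then have "t mod N = (t + 2 * n) mod N"
    by (simp add: g_eq)
  then show ?thesis
    using mod_eq_dvd_iff_nat[of t "t + 2 * n" N] by (simp add: N_def)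
qed simp

theorem theorem10:
  "\<exists>\<epsilon> :: nat \<Rightarrow> real. \<epsilon> \<longlonglongrightarrow> 0 \<and>
     (\<forall>n\<ge>7. \<forall>G. cyclic_gray_code n 2 G \<longrightarrow> efficiency n 2 G \<le> 3 / 4 + \<epsilon> n)"
proof (intro exI conjI allI impI)
  \<comment> \<open>The witness is the size bound \<open>2 * n\<close> divided by
    \<open>n * (n - 1) / 2\<close>, the number of words.\<close>
  show "(\<lambda>n. 4 / (real n - 1)) \<longlonglongrightarrow> 0"
    by real_asymp
next
  fix n :: nat and G
  assume n: "7 \<le> n" and G: "cyclic_gray_code n 2 G"
  have "length G \<le> 2 * n"
    using cyclic_gray_code_weight2_length_dvd[OF G] n by (intro dvd_imp_le) auto
  then have len: "real (length G) \<le> 2 * real n"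
    by (metis of_nat_le_iff of_nat_mult of_nat_numeral)
  have choose: "real (n choose 2) = real n * (real n - 1) / 2"
    using n by (simp add: choose_two real_of_nat_div)
  have "efficiency n 2 G \<le> 2 * real n / (real n * (real n - 1) / 2)"
    unfolding efficiency_def choose using len n by (intro divide_right_mono) auto
  also have "\<dots> = 4 / (real n - 1)"
    using n by (simp add: field_simps)
  finally show "efficiency n 2 G \<le> 3 / 4 + 4 / (real n - 1)"
    by simp
qed

end
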